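(* Suppose that $B_n\le\frac32$ for every integer $n\ge15$. Then for every integer $n\ge2$, \[ \left\lceil\operatorname{CW}(G_n)\right\rceil\le \operatorname{R}(G_n)\le\left\lceil\operatorname{CW}(G_n)\right\rceil+2 . \]
   Context: For an integer $n\ge2$, $G_n$ is the simple graph with vertex set $\{2,\ldots,n\}$ in which two distinct vertices $x,y$ are adjacent if and only if $\gcd(x,y)>1$. The Caro--Wei sum is $\operatorname{CW}(G)=\sum_{v}\frac1{d_G(v)+1}$. Havel--Hakimi trajectory: let $\mathbf d^{(0)}$ be the degree sequence of $G_n$ in nonincreasing order. Given $\mathbf d^{(j)}$ with largest term $D_j=d^{(j)}_1>0$ (the pivot), delete $d^{(j)}_1$, subtract one from each of $d^{(j)}_2,\ldots,d^{(j)}_{D_j+1}$ (the selected degrees), and reorder in nonincreasing order to get $\mathbf d^{(j+1)}$. Stop at the first all-zero sequence $\mathbf d^{(s)}$; the number of its zeros is the residue $\operatorname{R}(G_n)$. Put \[ \delta_j=\sum_{i=2}^{D_j+1}\frac{1}{d_i^{(j)}(d_i^{(j)}+1)}-\frac{1}{D_j+1}\qquad(0\le j<s). \] Step $j$ is a unit-band step if every selected degree belongs to $\{D_j,D_j-1\}$. For $n\ge4$, let $\tau_n$ be the index of the first unit-band step for $G_n$, with $\tau_n=s$ if none occurs, and let $B_n=\sum_{j<\tau_n}\delta_j$. *)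

theory Defs
  imports Complex_Main "HOL-Library.Multiset"
begin

text \<open>
  A simple graph is given by a finite vertex set \<open>V\<close> and an adjacency relation \<open>E\<close> that is
  symmetric and irreflexive on \<open>V\<close>.
\<close>

definition graph_degree :: "'a set \<Rightarrow> ('a \<Rightarrow> 'a \<Rightarrow> bool) \<Rightarrow> 'a \<Rightarrow> nat" where
  "graph_degree V E v = card {w \<in> V. E v w}"

definition caro_wei :: "'a set \<Rightarrow> ('a \<Rightarrow> 'a \<Rightarrow> bool) \<Rightarrow> real" where
  "caro_wei V E = (\<Sum>v\<in>V. 1 / (real (graph_degree V E v) + 1))"

definition sort_desc :: "nat list \<Rightarrow> nat list" where
  "sort_desc xs = rev (sort xs)"

definition degree_sequence :: "'a set \<Rightarrow> ('a \<Rightarrow> 'a \<Rightarrow> bool) \<Rightarrow> nat list" where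
  "degree_sequence V E = rev (sorted_list_of_multiset (image_mset (graph_degree V E) (mset_set V)))"

text \<open>
  Lists are indexed from 0, so \<open>d ! 0\<close> is the pivot \<open>D\<close> and the selected degrees are
  \<open>d ! 1, \<dots>, d ! D\<close>. By the Havel--Hakimi theorem every term of a trajectory that starts at
  the degree sequence of a simple graph is again such a sequence; hence at each step with
  \<open>D > 0\<close> the selected positions exist and carry positive entries, so the truncated
  subtraction below never takes effect.
\<close>

fun hh_step :: "nat list \<Rightarrow> nat list" where
  "hh_step [] = []"
| "hh_step (D # ds) = sort_desc (map (\<lambda>x. x - 1) (take D ds) @ drop D ds)"

definition hh_trajectory :: "nat list \<Rightarrow> nat \<Rightarrow> nat list" where
  "hh_trajectory d j = (hh_step ^^ j) d"

definition hh_stop :: "nat list \<Rightarrow> nat" where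
  "hh_stop d = (LEAST j. \<forall>x\<in>set (hh_trajectory d j). x = 0)"

definition hh_residue :: "nat list \<Rightarrow> nat" where
  "hh_residue d = count_list (hh_trajectory d (hh_stop d)) 0"

definition step_delta :: "nat list \<Rightarrow> real" where
  "step_delta d =
     (\<Sum>i = 1..d ! 0. 1 / (real (d ! i) * (real (d ! i) + 1))) - 1 / (real (d ! 0) + 1)"

definition unit_band :: "nat list \<Rightarrow> bool" where
  "unit_band d \<longleftrightarrow> (\<forall>i\<in>{1..d ! 0}. d ! i \<in> {d ! 0, d ! 0 - 1})"

definition first_unit_band :: "nat list \<Rightarrow> nat" where
  "first_unit_band d =
     (if \<exists>j<hh_stop d. unit_band (hh_trajectory d j)
      then (LEAST j. unit_band (hh_trajectory d j))
      else hh_stop d)"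

definition delta_sum :: "nat list \<Rightarrow> real" where
  "delta_sum d = (\<Sum>j<first_unit_band d. step_delta (hh_trajectory d j))"

definition gcd_vertices :: "nat \<Rightarrow> nat set" where
  "gcd_vertices n = {2..n}"

definition gcd_adj :: "nat \<Rightarrow> nat \<Rightarrow> bool" where
  "gcd_adj x y \<longleftrightarrow> x \<noteq> y \<and> gcd x y > 1"

definition gcd_sequence :: "nat \<Rightarrow> nat list" where
  "gcd_sequence n = degree_sequence (gcd_vertices n) gcd_adj"

definition CW_gcd :: "nat \<Rightarrow> real" where
  "CW_gcd n = caro_wei (gcd_vertices n) gcd_adj"

definition R_gcd :: "nat \<Rightarrow> nat" where
  "R_gcd n = hh_residue (gcd_sequence n)"

definition B_gcd :: "nat \<Rightarrow> real" where
  "B_gcd n = delta_sum (gcd_sequence n)"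

end

theory Submission
  imports Defs
begin

text \<open>
  A Havel--Hakimi step with pivot \<open>D\<close> changes the Caro--Wei sum by exactly \<open>\<delta>\<close>, and at the end of
  the trajectory the sum equals the residue, so the residue is the Caro--Wei sum plus all \<open>\<delta>\<^sub>j\<close>.
  Every \<open>\<delta>\<^sub>j\<close> is nonnegative since the selected degrees are at most \<open>D\<close>.
  A step after a unit-band step is again unit-band. In a unit-band step \<open>\<delta>\<close> is zero if all selected
  degrees are \<open>D\<close>; otherwise \<open>\<delta> \<le> 2 / ((D - 1) (D + 1))\<close> and the pivot drops strictly.
  Hence the unit-band steps contribute less than \<open>\<Sum>k\<ge>2. 2 / ((k - 1) (k + 1)) = 3 / 2\<close>, and
  the total of the \<open>\<delta>\<^sub>j\<close> stays below 3.
\<close>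

section \<open>The Havel--Hakimi theorem\<close>

text \<open>The classical edge switch. As \<open>k\<close> has the neighbour \<open>v\<close>, which
  \<open>i\<close> lacks, and \<open>i\<close> has at least the degree of \<open>k\<close>, some
  \<open>w\<close> is adjacent to \<open>i\<close> but not to \<open>k\<close>. Replacing the edges
  \<open>vk\<close> and \<open>iw\<close> by \<open>vi\<close> and \<open>kw\<close> preserves all
  degrees.\<close>

lemma graph_degree_switch:
  assumes fin: "finite V" and sym: "symp E" and irr: "irreflp E"
    and V: "v \<in> V" "i \<in> V" "k \<in> V"
    and "E v k" "\<not> E v i" "i \<noteq> v" and deg: "graph_degree V E k \<le> graph_degree V E i"
  shows "\<exists>E'. symp E' \<and> irreflp E' \<and> (\<forall>x\<in>V. graph_degree V E' x = graph_degree V E x) \<and>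
    {w \<in> V. E' v w} = insert i ({w \<in> V. E v w} - {k})"
proof -
  have s: "E x y \<longleftrightarrow> E y x" for x y using sym by (meson sympD)
  have ir: "\<not> E x x" for x using irr by (simp add: irreflp_def)
  define N where "N x = {w \<in> V. E x w}" for x
  have finN: "finite (N x)" for x using fin by (simp add: N_def)
  have "k \<noteq> i" "k \<noteq> v" using assms(7,8) ir by auto
  \<comment> \<open>Otherwise every neighbour of \<open>i\<close> other than \<open>k\<close> is a
    neighbour of \<open>k\<close> other than \<open>i\<close> and \<open>v\<close>. Since
    \<open>v\<close> itself is lost in this inclusion, \<open>i\<close> would have smaller degree
    than \<open>k\<close>; a possible edge \<open>ik\<close> counts equally on both sides.\<close>
  have "\<exists>w\<in>V. E i w \<and> \<not> E k w \<and> w \<noteq> k"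
  proof (rule ccontr)
    assume "\<not> ?thesis"
    then have "N i - {k} \<subseteq> N k - {i} - {v}"
      using assms(8) ir s by (auto simp: N_def)
    then have "card (N i - {k}) \<le> card (N k - {i} - {v})" by (intro card_mono) (auto simp: finN)
    also have "\<dots> < card (N k - {i})"
    proof (rule psubset_card_mono)
      show "N k - {i} - {v} \<subset> N k - {i}" using assms(7,9) V s by (auto simp: N_def)
    qed (simp add: finN)
    finally have lt: "card (N i - {k}) < card (N k - {i})" .
    have "i \<in> N k \<longleftrightarrow> k \<in> N i" using V s by (auto simp: N_def)
    moreover have "card (N k) \<le> card (N i)" using deg by (simp add: N_def graph_degree_def)
    ultimately show False using lt finN
      by (cases "i \<in> N k") (auto simp: card_Diff_singleton)
  qed
  then obtain w where w: "w \<in> V" "E i w" "\<not> E k w" "w \<noteq> k" by blast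
  have "w \<noteq> i" "w \<noteq> v" using w ir assms(8) s by auto
  note ne = \<open>w \<noteq> i\<close> \<open>w \<noteq> v\<close> \<open>w \<noteq> k\<close> \<open>k \<noteq> i\<close> \<open>k \<noteq> v\<close> \<open>i \<noteq> v\<close>
  \<comment> \<open>Writing edges as unordered pairs makes the symmetry of \<open>E'\<close>
    immediate.\<close>
  define E' where "E' x y \<longleftrightarrow>
    {x, y} \<noteq> {v, k} \<and> {x, y} \<noteq> {i, w} \<and> (E x y \<or> {x, y} = {v, i} \<or> {x, y} = {k, w})" for x y
  have swap: "card {y \<in> V. E' x y} = card (N x)"
    if "{y \<in> V. E' x y} = insert a (N x - {b})" "a \<notin> N x" "b \<in> N x" for x a b
  proof -
    have "0 < card (N x)" using that(3) finN by (auto simp: card_gt_0_iff)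
    then show ?thesis using that finN by simp
  qed
  have Nv: "{y \<in> V. E' v y} = insert i (N v - {k})"
    using V w ne s ir by (auto simp: E'_def N_def doubleton_eq_iff)
  have Ni: "{y \<in> V. E' i y} = insert v (N i - {w})"
    using V w ne s ir by (auto simp: E'_def N_def doubleton_eq_iff)
  have Nk: "{y \<in> V. E' k y} = insert w (N k - {v})"
    using V w ne s ir by (auto simp: E'_def N_def doubleton_eq_iff)
  have Nw: "{y \<in> V. E' w y} = insert k (N w - {i})"
    using V w ne s ir by (auto simp: E'_def N_def doubleton_eq_iff)
  have No: "{y \<in> V. E' x y} = N x" if "x \<notin> {v, i, k, w}" for x
    using that by (auto simp: E'_def N_def doubleton_eq_iff)
  have "card {y \<in> V. E' x y} = card (N x)" for x
  proof -
    consider "x = v" | "x = i" | "x = k" | "x = w" | "x \<notin> {v, i, k, w}" by blast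
    then show ?thesis
    proof cases
      case 1
      show ?thesis unfolding 1 by (rule swap[OF Nv]) (use assms(7,8) V in \<open>auto simp: N_def\<close>)
    next
      case 2
      show ?thesis unfolding 2 by (rule swap[OF Ni]) (use assms(7,8) V w s in \<open>auto simp: N_def\<close>)
    next
      case 3
      show ?thesis unfolding 3 by (rule swap[OF Nk]) (use assms(7,8) V w s in \<open>auto simp: N_def\<close>)
    next
      case 4
      show ?thesis unfolding 4 by (rule swap[OF Nw]) (use assms(7,8) V w s in \<open>auto simp: N_def\<close>)
    qed (simp add: No)
  qed
  moreover have "symp E'" using s by (auto simp: symp_def E'_def insert_commute)
  moreover have "irreflp E'" using ir ne by (auto simp: irreflp_def E'_def doubleton_eq_iff)
  ultimately show ?thesis using Nv by (auto simp: graph_degree_def N_def)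
qed

text \<open>Induction on the number of vertices of \<open>S\<close> not adjacent to
  \<open>v\<close>. Since \<open>S\<close> has as many elements as \<open>v\<close> has neighbours,
  a missing \<open>i\<close> in \<open>S\<close> comes with a neighbour \<open>k\<close> outside
  \<open>S\<close>, and the switch trades \<open>k\<close> for \<open>i\<close>.\<close>

lemma graph_degree_prescribed_neighbours:
  assumes "finite V" "symp E" "irreflp E" "v \<in> V" "S \<subseteq> V - {v}" "card S = graph_degree V E v"
    and "\<And>x y. x \<in> S \<Longrightarrow> y \<in> V - {v} - S \<Longrightarrow> graph_degree V E y \<le> graph_degree V E x"
  shows "\<exists>E'. symp E' \<and> irreflp E' \<and> (\<forall>x\<in>V. graph_degree V E' x = graph_degree V E x) \<and>
    {w \<in> V. E' v w} = S"
  using assms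
proof (induction "card (S - {w \<in> V. E v w})" arbitrary: E rule: less_induct)
  case less
  let ?N = "{w \<in> V. E v w}"
  have fin: "finite S" "finite ?N" using less.prems(1,5) by (auto intro: finite_subset)
  show ?case
  proof (cases "S \<subseteq> ?N")
    case True
    then have "?N = S" using card_subset_eq[of ?N S] fin less.prems(6) by (simp add: graph_degree_def)
    then show ?thesis using less.prems by blast
  next
    case False
    then obtain i where i: "i \<in> S" "i \<notin> ?N" by blast
    have "\<not> ?N \<subseteq> S"
      using card_subset_eq[of S ?N] fin less.prems(6) i by (auto simp: graph_degree_def)
    then obtain k where k: "k \<in> ?N" "k \<notin> S" by blast
    have "k \<noteq> v" using k less.prems(3) by (auto simp: irreflp_def)
    have iV: "i \<in> V" "i \<noteq> v" using i less.prems(5) by auto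
    obtain E' where E': "symp E'" "irreflp E'"
      "\<forall>x\<in>V. graph_degree V E' x = graph_degree V E x"
      "{w \<in> V. E' v w} = insert i (?N - {k})"
      using graph_degree_switch[OF less.prems(1-3), of v i k] less.prems(4,7) i k iV \<open>k \<noteq> v\<close>
      by (auto simp del: Collect_conj_eq)
    have "S - {w \<in> V. E' v w} \<subset> S - ?N" using E'(4) i k by auto
    then have "card (S - {w \<in> V. E' v w}) < card (S - ?N)"
      using fin by (intro psubset_card_mono) auto
    then have "\<exists>E''. symp E'' \<and> irreflp E'' \<and>
      (\<forall>x\<in>V. graph_degree V E'' x = graph_degree V E' x) \<and> {w \<in> V. E'' v w} = S"
    proof (rule less.hyps[OF _ less.prems(1) E'(1,2) less.prems(4,5)])
      show "card S = graph_degree V E' v" using E'(3) less.prems(4,6) by simp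
      show "graph_degree V E' y \<le> graph_degree V E' x" if "x \<in> S" "y \<in> V - {v} - S" for x y
      proof -
        have "x \<in> V" "y \<in> V" using that less.prems(5) by auto
        then show ?thesis using less.prems(7)[OF that] E'(3) by simp
      qed
    qed
    then obtain E'' where E'': "symp E''" "irreflp E''" "{w \<in> V. E'' v w} = S"
      "\<forall>x\<in>V. graph_degree V E'' x = graph_degree V E' x"
      by (elim exE conjE)
    have "\<forall>x\<in>V. graph_degree V E'' x = graph_degree V E x"
    proof
      fix x assume "x \<in> V"
      with E''(4) E'(3) show "graph_degree V E'' x = graph_degree V E x" by (metis (no_types))
    qed
    with E'' show ?thesis by (intro exI[of _ E''] conjI)
  qed
qed

text \<open>Degrees are listed along an enumeration of the vertices, in any order, so that a segment
  of the list, such as the selected degrees, corresponds to a set of vertices.\<close>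

definition graphic :: "nat list \<Rightarrow> bool" where
  "graphic d \<longleftrightarrow> (\<exists>(vs :: nat list) E. distinct vs \<and> symp E \<and> irreflp E \<and>
     d = map (graph_degree (set vs) E) vs)"

text \<open>Lifts a reordering of the degrees to a reordering of the vertices.\<close>

lemma mset_eq_mapE:
  assumes "mset ys = mset (map f xs)"
  obtains zs where "mset zs = mset xs" "ys = map f zs"
proof -
  have "\<exists>zs. mset zs = mset xs \<and> ys = map f zs"
    using assms
  proof (induction ys arbitrary: xs)
    case (Cons y ys)
    then have "y \<in> set (map f xs)" by (metis list.set_intros(1) mset_eq_setD)
    then obtain x where x: "x \<in> set xs" "y = f x" by auto
    then obtain xs' where m: "mset xs = add_mset x (mset xs')"
      by (metis insert_DiffM ex_mset set_mset_mset)
    have "mset ys = mset (map f xs')" using Cons.prems x m by simp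
    from Cons.IH[OF this] obtain zs where "mset zs = mset xs'" "ys = map f zs" by blast
    then show ?case using x m by (intro exI[of _ "x # zs"]) simp
  qed simp
  then show ?thesis using that by blast
qed

lemma graphic_cong_mset:
  assumes "graphic xs" "mset ys = mset xs"
  shows "graphic ys"
proof -
  obtain vs E where vs: "distinct vs" "symp E" "irreflp E" "xs = map (graph_degree (set vs) E) (vs :: nat list)"
    using assms(1) by (auto simp: graphic_def)
  then obtain zs where zs: "mset zs = mset vs" "ys = map (graph_degree (set vs) E) zs"
    using assms(2) mset_eq_mapE by metis
  then have "set zs = set vs" "distinct zs"
    using vs(1) by (auto dest: mset_eq_setD mset_eq_imp_distinct_iff)
  with zs vs have "distinct zs \<and> symp E \<and> irreflp E \<and> ys = map (graph_degree (set zs) E) zs" by simp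
  then show ?thesis unfolding graphic_def by blast
qed

text \<open>The graph may be changed, without changing degrees, so that the vertex of the pivot is
  joined exactly to the next \<open>D\<close> vertices of the list. Deleting that vertex then lowers
  exactly their degrees.\<close>

theorem havel_hakimi:
  assumes "graphic (D # ds)" "sorted_wrt (\<ge>) ds"
  shows "D \<le> length ds" "\<And>x. x \<in> set (take D ds) \<Longrightarrow> 0 < x"
    "graphic (map (\<lambda>x. x - 1) (take D ds) @ drop D ds)"
proof -
  obtain us E where us: "distinct us" "symp E" "irreflp E"
    "D # ds = map (graph_degree (set us) E) (us :: nat list)"
    using assms(1) unfolding graphic_def by (elim exE conjE)
  then obtain v vs where v: "us = v # vs" by (cases us) auto
  define V where "V = set us"
  define S where "S = set (take D vs)"
  have ds: "ds = map (graph_degree V E) vs" and D: "D = graph_degree V E v"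
    using us(4) v by (auto simp: V_def)
  have dist: "v \<notin> set vs" "distinct vs" and V: "V = insert v (set vs)" "finite V"
    using us(1) v by (auto simp: V_def)
  have "{w \<in> V. E v w} \<subseteq> set vs" using us(3) V by (auto simp: irreflp_def)
  then have "D \<le> card (set vs)" unfolding D graph_degree_def by (intro card_mono) auto
  then have Dle: "D \<le> length vs" using dist by (simp add: distinct_card)
  then show "D \<le> length ds" by (simp add: ds)
  have VS: "V - {v} - S = set (drop D vs)" "S \<subseteq> set vs"
    using dist V set_take_disj_set_drop_if_distinct[of vs D D] append_take_drop_id[of D vs]
      set_append[of "take D vs" "drop D vs"]
    by (auto simp: S_def dest: in_set_takeD in_set_dropD)
  have "graph_degree V E y \<le> graph_degree V E x" if "x \<in> S" "y \<in> V - {v} - S" for x y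
  proof -
    have "sorted_wrt (\<ge>) (map (graph_degree V E) (take D vs) @ map (graph_degree V E) (drop D vs))"
      using assms(2) by (simp add: ds flip: map_append)
    then show ?thesis using that unfolding VS(1) by (auto simp: S_def sorted_wrt_append)
  qed
  moreover have "card S = graph_degree V E v"
    using Dle dist D by (simp add: S_def distinct_card)
  moreover have "S \<subseteq> V - {v}" using VS(2) V dist by auto
  ultimately obtain F where F: "symp F" "irreflp F"
    "\<And>x. x \<in> V \<Longrightarrow> graph_degree V F x = graph_degree V E x" "{w \<in> V. F v w} = S"
    using graph_degree_prescribed_neighbours[OF V(2) us(2,3), of v S] V(1) by blast
  \<comment> \<open>Passing from \<open>V\<close> to \<open>set vs\<close> removes \<open>v\<close>,
    which costs a degree exactly for its neighbours under \<open>F\<close>, that is, for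
    \<open>S\<close>.\<close>
  have deg: "graph_degree V E x = graph_degree (set vs) F x + (if x \<in> S then 1 else 0)"
    if "x \<in> set vs" for x
  proof -
    have "F x v \<longleftrightarrow> x \<in> S" using F(1,4) that V by (auto simp: symp_def)
    then have "{w \<in> V. F x w} = (if x \<in> S then insert v {w \<in> set vs. F x w} else {w \<in> set vs. F x w})"
      using V by auto
    then show ?thesis using F(3)[of x] that V dist by (auto simp: graph_degree_def)
  qed
  show "0 < x" if "x \<in> set (take D ds)" for x
    using that deg VS(2) by (auto simp: ds S_def take_map)
  have "map (\<lambda>x. x - 1) (take D ds) = map (graph_degree (set vs) F) (take D vs)"
    using deg VS(2) by (auto simp: ds take_map S_def)
  moreover have "graph_degree V E x = graph_degree (set vs) F x" if "x \<in> set (drop D vs)" for x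
  proof -
    have "x \<notin> S" using that VS(1) by blast
    then show ?thesis using deg[OF in_set_dropD[OF that]] by simp
  qed
  then have "drop D ds = map (graph_degree (set vs) F) (drop D vs)"
    by (simp add: ds drop_map)
  ultimately have "map (\<lambda>x. x - 1) (take D ds) @ drop D ds = map (graph_degree (set vs) F) vs"
    by (simp flip: map_append)
  then show "graphic (map (\<lambda>x. x - 1) (take D ds) @ drop D ds)"
    using F dist unfolding graphic_def by blast
qed

lemma mset_degree_sequence:
  "mset (degree_sequence V E) = image_mset (graph_degree V E) (mset_set V)"
  by (simp add: degree_sequence_def)

lemma degree_sequence_set:
  "distinct vs \<Longrightarrow> degree_sequence (set vs) E = sort_desc (map (graph_degree (set vs) E) vs)"
  by (simp add: degree_sequence_def mset_set_set sort_desc_def flip: mset_map)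

lemma graphic_degree_sequence:
  assumes "finite V" "symp E" "irreflp E"
  shows "graphic (degree_sequence V (E :: nat \<Rightarrow> nat \<Rightarrow> bool))"
proof -
  obtain vs where vs: "set vs = V" "distinct vs" using assms(1) finite_distinct_list by blast
  then have "graphic (map (graph_degree V E) vs)" using assms by (auto simp: graphic_def)
  moreover have "mset (degree_sequence V E) = mset (map (graph_degree V E) vs)"
    using vs(2) by (simp add: mset_degree_sequence mset_set_set flip: vs(1))
  ultimately show ?thesis by (rule graphic_cong_mset)
qed

section \<open>The Caro--Wei sum along a trajectory\<close>

text \<open>The invariant of a trajectory.\<close>

definition graphic_desc :: "nat list \<Rightarrow> bool" where
  "graphic_desc d \<longleftrightarrow> graphic d \<and> sorted_wrt (\<ge>) d"

text \<open>The Caro--Wei sum read off from a degree list, so that it makes sense along the whole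
  trajectory.\<close>

definition recip_sum :: "nat list \<Rightarrow> real" where
  "recip_sum d = (\<Sum>x\<leftarrow>d. 1 / (real x + 1))"

lemma mset_sort_desc [simp]: "mset (sort_desc xs) = mset xs"
  by (simp add: sort_desc_def)

lemma length_sort_desc [simp]: "length (sort_desc xs) = length xs"
  by (simp add: sort_desc_def)

lemma sorted_sort_desc: "sorted_wrt (\<ge>) (sort_desc xs)"
  by (simp add: sort_desc_def sorted_wrt_rev)

lemma recip_sum_cong: "mset xs = mset ys \<Longrightarrow> recip_sum xs = recip_sum ys"
  unfolding recip_sum_def by (metis mset_map sum_mset_sum_list)

lemma recip_sum_degree_sequence: "recip_sum (degree_sequence V E) = caro_wei V E"
proof -
  have "recip_sum (degree_sequence V E) =
      (\<Sum>x\<in>#mset (degree_sequence V E). 1 / (real x + 1))"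
    by (simp add: recip_sum_def flip: sum_mset_sum_list)
  then show ?thesis
    by (simp add: mset_degree_sequence caro_wei_def sum_unfold_sum_mset image_mset.compositionality o_def)
qed

lemma graphic_desc_degree_sequence:
  assumes "finite V" "symp E" "irreflp E"
  shows "graphic_desc (degree_sequence V (E :: nat \<Rightarrow> nat \<Rightarrow> bool))"
  using graphic_degree_sequence[OF assms]
  by (simp add: graphic_desc_def degree_sequence_def sorted_wrt_rev)

lemma graphic_desc_Cons:
  assumes "graphic_desc (D # ds)"
  shows "D \<le> length ds" "\<And>x. x \<in> set (take D ds) \<Longrightarrow> 0 < x" "\<And>x. x \<in> set ds \<Longrightarrow> x \<le> D"
    "graphic_desc (hh_step (D # ds))"
proof -
  have g: "graphic (D # ds)" and s: "sorted_wrt (\<ge>) ds" and le: "\<And>x. x \<in> set ds \<Longrightarrow> x \<le> D"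
    using assms by (auto simp: graphic_desc_def)
  show "D \<le> length ds" "\<And>x. x \<in> set (take D ds) \<Longrightarrow> 0 < x" "\<And>x. x \<in> set ds \<Longrightarrow> x \<le> D"
    using havel_hakimi(1,2)[OF g s] le by auto
  show "graphic_desc (hh_step (D # ds))"
    using havel_hakimi(3)[OF g s] sorted_sort_desc
    by (auto simp: graphic_desc_def intro: graphic_cong_mset)
qed

lemma step_delta_Cons:
  assumes "D \<le> length ds"
  shows "step_delta (D # ds) = (\<Sum>x\<leftarrow>take D ds. 1 / (real x * (real x + 1))) - 1 / (real D + 1)"
proof -
  have "(\<Sum>i = 1..D. 1 / (real ((D # ds) ! i) * (real ((D # ds) ! i) + 1))) =
      (\<Sum>i<D. 1 / (real (ds ! i) * (real (ds ! i) + 1)))"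
    by (rule sum.reindex_bij_witness[where j = "\<lambda>i. i - 1" and i = Suc]) auto
  also have "\<dots> = (\<Sum>x\<leftarrow>take D ds. 1 / (real x * (real x + 1)))"
    using assms by (simp add: sum_list_sum_nth atLeast0LessThan)
  finally show ?thesis by (simp add: step_delta_def)
qed

text \<open>Lowering a positive \<open>x\<close> by one raises \<open>1 / (x + 1)\<close> by
  \<open>1 / (x * (x + 1))\<close>, and deleting the pivot loses \<open>1 / (D + 1)\<close>.\<close>

lemma recip_sum_hh_step:
  assumes "graphic_desc (D # ds)"
  shows "recip_sum (hh_step (D # ds)) = recip_sum (D # ds) + step_delta (D # ds)"
proof -
  note c = graphic_desc_Cons[OF assms]
  let ?f = "\<lambda>x. 1 / (real x + 1)"
  have "1 / (real (x - 1) + 1) = ?f x + 1 / (real x * (real x + 1))" if "x \<in> set (take D ds)" for x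
  proof -
    have "1 / r = 1 / (r + 1) + 1 / (r * (r + 1))" if "0 < r" for r :: real
      using that by (simp add: divide_simps)
    from this[of "real x"] show ?thesis using c(2)[OF that] by (simp add: of_nat_diff)
  qed
  then have "(\<Sum>x\<leftarrow>take D ds. 1 / (real (x - 1) + 1)) =
      (\<Sum>x\<leftarrow>take D ds. ?f x + 1 / (real x * (real x + 1)))"
    by (intro arg_cong[where f = sum_list] map_cong) auto
  also have "\<dots> = (\<Sum>x\<leftarrow>take D ds. ?f x) + (\<Sum>x\<leftarrow>take D ds. 1 / (real x * (real x + 1)))"
    by (rule sum_list_addf)
  finally have "recip_sum (map (\<lambda>x. x - 1) (take D ds)) =
      recip_sum (take D ds) + (\<Sum>x\<leftarrow>take D ds. 1 / (real x * (real x + 1)))"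
    by (simp add: recip_sum_def o_def)
  moreover have "recip_sum ds = recip_sum (take D ds) + recip_sum (drop D ds)"
    by (simp add: recip_sum_def flip: sum_list_append map_append)
  moreover have "recip_sum (hh_step (D # ds)) =
      recip_sum (map (\<lambda>x. x - 1) (take D ds)) + recip_sum (drop D ds)"
    unfolding hh_step.simps recip_sum_cong[OF mset_sort_desc] by (simp add: recip_sum_def)
  ultimately show ?thesis
    by (simp add: step_delta_Cons[OF c(1)] recip_sum_def)
qed

lemma sum_list_ge_const:
  fixes f :: "'a \<Rightarrow> real" and c :: real
  shows "(\<And>x. x \<in> set xs \<Longrightarrow> c \<le> f x) \<Longrightarrow> real (length xs) * c \<le> (\<Sum>x\<leftarrow>xs. f x)"
  using sum_list_mono[of xs "\<lambda>_. c" f] by (simp add: sum_list_triv)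

lemma sum_list_le_const:
  fixes f :: "'a \<Rightarrow> real" and c :: real
  shows "(\<And>x. x \<in> set xs \<Longrightarrow> f x \<le> c) \<Longrightarrow> (\<Sum>x\<leftarrow>xs. f x) \<le> real (length xs) * c"
  using sum_list_mono[of xs f "\<lambda>_. c"] by (simp add: sum_list_triv)

text \<open>Each of the \<open>D\<close> selected degrees contributes at least
  \<open>1 / (D * (D + 1))\<close>, and together these minorants equal the subtracted
  \<open>1 / (D + 1)\<close>.\<close>

lemma step_delta_nonneg:
  assumes "graphic_desc (D # ds)" "0 < D"
  shows "0 \<le> step_delta (D # ds)"
proof -
  note c = graphic_desc_Cons[OF assms(1)]
  have "length (take D ds) * (1 / (real D * (real D + 1))) \<le> (\<Sum>x\<leftarrow>take D ds. 1 / (real x * (real x + 1)))"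
  proof (rule sum_list_ge_const)
    fix x assume "x \<in> set (take D ds)"
    with c(2,3) have "0 < x" "x \<le> D" by (auto dest: in_set_takeD)
    then show "1 / (real D * (real D + 1)) \<le> 1 / (real x * (real x + 1))"
      by (intro divide_left_mono mult_mono mult_pos_pos) auto
  qed
  then show ?thesis using c(1) assms(2) by (simp add: step_delta_Cons)
qed

section \<open>Unit-band steps\<close>

text \<open>Turns a count of large entries into information about positions; the count survives the
  reordering in a step.\<close>

lemma sorted_desc_nth_ge:
  fixes c :: "'a :: linorder"
  assumes "sorted_wrt (\<ge>) d" "i < length (filter (\<lambda>x. c \<le> x) d)"
  shows "c \<le> d ! i"
  using assms
proof (induction d arbitrary: i)
  case (Cons x d)
  show ?case
  proof (cases "c \<le> x")
    case True
    with Cons show ?thesis by (cases i) auto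
  next
    case False
    with Cons.prems(1) have "filter (\<lambda>x. c \<le> x) (x # d) = []"
      by (auto simp: filter_empty_conv)
    with Cons.prems(2) show ?thesis by (metis list.size(3) not_less0)
  qed
qed simp

text \<open>No selected degree exceeds the pivot, so only the lower end of the band has to be
  checked.\<close>

lemma unit_band_Cons:
  assumes "graphic_desc (D # ds)"
  shows "unit_band (D # ds) \<longleftrightarrow> (\<forall>x\<in>set (take D ds). D - 1 \<le> x)"
proof -
  have shift: "(\<forall>i\<in>{1..D}. P i) \<longleftrightarrow> (\<forall>i<D. P (Suc i))" for P
  proof (intro iffI ballI allI impI)
    fix i assume "\<forall>i<D. P (Suc i)" "i \<in> {1..D}"
    then show "P i" by (cases i) auto
  qed simp
  have "unit_band (D # ds) \<longleftrightarrow> (\<forall>i<D. ds ! i \<in> {D, D - 1})"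
    by (simp only: unit_band_def nth_Cons_0 shift nth_Cons_Suc)
  also have "\<dots> \<longleftrightarrow> (\<forall>i<D. D - 1 \<le> ds ! i)"
  proof (intro all_cong)
    fix i assume "i < D"
    then have "ds ! i \<le> D" using graphic_desc_Cons(1,3)[OF assms] by (meson less_le_trans nth_mem)
    then show "ds ! i \<in> {D, D - 1} \<longleftrightarrow> D - 1 \<le> ds ! i" by auto
  qed
  also have "\<dots> \<longleftrightarrow> (\<forall>x\<in>set (take D ds). D - 1 \<le> x)"
    using graphic_desc_Cons(1)[OF assms] by (auto simp: all_set_conv_all_nth)
  finally show ?thesis .
qed

text \<open>The next step is unit-band as soon as more than \<open>D'\<close> entries of the new
  list are at least \<open>D' - 1\<close>. The \<open>D\<close> lowered entries supply these, with
  one unselected entry added if the pivot stays at \<open>D\<close>.\<close>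

lemma unit_band_hh_step:
  assumes d: "graphic_desc (D # ds)" and "0 < D" and ub: "unit_band (D # ds)"
    and step: "hh_step (D # ds) = D' # es"
  shows "unit_band (D' # es)" "D' \<le> D" "(\<exists>x\<in>set (take D ds). x \<noteq> D) \<Longrightarrow> D' < D"
proof -
  note c = graphic_desc_Cons[OF d]
  define xs where "xs = map (\<lambda>x. x - 1) (take D ds)"
  have band: "\<And>x. x \<in> set (take D ds) \<Longrightarrow> D - 1 \<le> x" using ub unit_band_Cons[OF d] by blast
  have e: "mset (D' # es) = mset xs + mset (drop D ds)"
    using step by (metis hh_step.simps(2) mset_append mset_sort_desc xs_def)
  have gd: "graphic_desc (D' # es)" using c(4) step by simp
  note c' = graphic_desc_Cons[OF gd]
  have lx: "length xs = D" using c(1) by (simp add: xs_def)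
  have xge: "D - 2 \<le> x" if "x \<in> set xs" for x using that band by (fastforce simp: xs_def)
  have D'mem: "D' \<in> set xs \<union> set (drop D ds)"
    using arg_cong[OF e, of set_mset] by auto
  have xlt: "x < D" if "x \<in> set xs" for x
    using that c(3) \<open>0 < D\<close> by (fastforce simp: xs_def dest: in_set_takeD)
  show "D' \<le> D" using D'mem xlt c(3) by (fastforce dest: in_set_dropD less_imp_le)
  \<comment> \<open>Lowered entries are below \<open>D\<close>, so a new pivot \<open>D\<close> was
    an unselected entry, and by sortedness every selected entry is then at least
    \<open>D\<close>.\<close>
  have top: "x = D" if "D' = D" "x \<in> set (take D ds)" for x
  proof -
    have "D \<in> set (drop D ds)" using that(1) D'mem xlt by blast
    moreover have "sorted_wrt (\<ge>) (take D ds @ drop D ds)" using d by (simp add: graphic_desc_def)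
    ultimately have "D \<le> x" using that(2) unfolding sorted_wrt_append by blast
    then show ?thesis using c(3) that(2) in_set_takeD le_antisym by metis
  qed
  show "D' < D" if "\<exists>x\<in>set (take D ds). x \<noteq> D"
    using that top \<open>D' \<le> D\<close> by (metis le_neq_implies_less)
  \<comment> \<open>If \<open>D' < D\<close>, the \<open>D\<close> lowered entries are at least
    \<open>D - 2\<close>, hence at least \<open>D' - 1\<close>. If \<open>D' = D\<close>, they all
    equal \<open>D - 1\<close>, and an unselected \<open>D\<close> makes the inequality
    strict.\<close>
  have cnt: "D' < length (filter (\<lambda>x. D' - 1 \<le> x) (D' # es))"
  proof -
    have "length (filter (\<lambda>x. D' - 1 \<le> x) (D' # es)) =
        length (filter (\<lambda>x. D' - 1 \<le> x) xs) + length (filter (\<lambda>x. D' - 1 \<le> x) (drop D ds))"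
      by (simp only: e mset_filter filter_union_mset size_union flip: size_mset)
    moreover have "filter (\<lambda>x. D' - 1 \<le> x) xs = xs"
    proof (cases "D' = D")
      case True
      then show ?thesis using top by (auto simp: xs_def filter_id_conv)
    next
      case False
      then show ?thesis using xge \<open>D' \<le> D\<close> by (fastforce simp: filter_id_conv)
    qed
    moreover have "0 < length (filter (\<lambda>x. D' - 1 \<le> x) (drop D ds))" if "D' = D"
    proof -
      have "D \<in> set (filter (\<lambda>x. D' - 1 \<le> x) (drop D ds))" using that D'mem xlt by auto
      then show ?thesis by (metis length_pos_if_in_set)
    qed
    ultimately show ?thesis using lx \<open>D' \<le> D\<close> by (cases "D' = D") auto
  qed
  have "D' - 1 \<le> es ! i" if "i < D'" for i
    using sorted_desc_nth_ge[of "D' # es" "Suc i"] gd cnt that by (simp add: graphic_desc_def del: filter.simps)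
  then show "unit_band (D' # es)"
    using c'(1) unfolding unit_band_Cons[OF gd] by (auto simp: all_set_conv_all_nth)
qed

text \<open>The telescoped value of \<open>\<Sum>k = 2..D. 2 / ((k - 1) * (k + 1))\<close>.\<close>

definition band_bound :: "nat \<Rightarrow> real" where
  "band_bound D = (if D = 0 then 0 else 3 / 2 - 1 / real D - 1 / (real D + 1))"

lemma band_bound_mono: "a \<le> b \<Longrightarrow> band_bound a \<le> band_bound b"
proof (cases "a = 0")
  case True
  \<comment> \<open>At \<open>b = 1\<close> the two reciprocals add up to exactly
    \<open>3 / 2\<close>, so the closed formula starts at the same value 0 that is assigned to
    \<open>D = 0\<close>.\<close>
  have "1 / real b \<le> 1 / 1" "1 / (real b + 1) \<le> 1 / 2" if "b \<noteq> 0"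
    using that by (auto intro!: divide_left_mono)
  then have "1 / real b + 1 / (real b + 1) \<le> 1 / 1 + 1 / 2" if "b \<noteq> 0"
    using that by (intro add_mono) auto
  then show ?thesis using True unfolding band_bound_def by (cases "b = 0") (simp_all del: div_by_1)
next
  case False
  assume "a \<le> b"
  then have "1 / real b \<le> 1 / real a" "1 / (real b + 1) \<le> 1 / (real a + 1)"
    using False by (auto intro!: divide_left_mono)
  then show ?thesis using False \<open>a \<le> b\<close> by (auto simp: band_bound_def)
qed

lemma band_bound_nonneg: "0 \<le> band_bound D"
  using band_bound_mono[of 0 D] by (simp add: band_bound_def)

lemma band_bound_less: "band_bound D < 3 / 2"
proof (cases "D = 0")
  case False
  then have "0 < 1 / real D + 1 / (real D + 1)" by (intro add_pos_pos) auto
  moreover have "band_bound D = 3 / 2 - 1 / real D - 1 / (real D + 1)"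
    using False by (simp add: band_bound_def)
  ultimately show ?thesis by linarith
qed (simp add: band_bound_def)

text \<open>\<open>band_bound\<close> of the pivot acts as a potential that pays for the step.
  Monotonicity covers pivots that fall by more than one.\<close>

lemma step_delta_unit_band:
  assumes d: "graphic_desc (D # ds)" and "0 < D" and ub: "unit_band (D # ds)"
    and step: "hh_step (D # ds) = D' # es"
  shows "step_delta (D # ds) + band_bound D' \<le> band_bound D"
proof -
  note c = graphic_desc_Cons[OF d] and u = unit_band_hh_step[OF assms]
  have band: "\<And>x. x \<in> set (take D ds) \<Longrightarrow> D - 1 \<le> x" using ub unit_band_Cons[OF d] by blast
  show ?thesis
  proof (cases "\<exists>x\<in>set (take D ds). x \<noteq> D")
    case False
    then have "(\<Sum>x\<leftarrow>take D ds. 1 / (real x * (real x + 1))) \<le> length (take D ds) * (1 / (real D * (real D + 1)))"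
      by (intro sum_list_le_const) auto
    then have "step_delta (D # ds) \<le> 0" using c(1) \<open>0 < D\<close> by (simp add: step_delta_Cons)
    then show ?thesis using band_bound_mono[OF u(2)] by linarith
  next
    case True
    then obtain x where "x \<in> set (take D ds)" "x < D"
      using c(3) by (metis in_set_takeD le_neq_implies_less)
    \<comment> \<open>A selected degree is positive and here one lies below \<open>D\<close>; hence
      the denominator \<open>D - 1\<close> below is nonzero.\<close>
    with c(2) have D2: "2 \<le> D" by fastforce
    have "(\<Sum>x\<leftarrow>take D ds. 1 / (real x * (real x + 1))) \<le> length (take D ds) * (1 / ((real D - 1) * real D))"
    proof (rule sum_list_le_const)
      fix x assume "x \<in> set (take D ds)"
      with band D2 have "real D - 1 \<le> real x" "real D \<le> real x + 1" "0 < x" by fastforce+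
      then show "1 / (real x * (real x + 1)) \<le> 1 / ((real D - 1) * real D)"
        using D2 by (intro divide_left_mono mult_mono mult_pos_pos) auto
    qed
    then have "step_delta (D # ds) \<le> 1 / (real D - 1) - 1 / (real D + 1)"
      using c(1) D2 by (simp add: step_delta_Cons)
    also have "\<dots> = band_bound D - band_bound (D - 1)"
      using D2 by (simp add: band_bound_def of_nat_diff)
    finally have "step_delta (D # ds) \<le> band_bound D - band_bound (D - 1)" .
    moreover have "D' \<le> D - 1" using u(3)[OF True] by simp
    ultimately show ?thesis using band_bound_mono by fastforce
  qed
qed

section \<open>The residue\<close>

lemma hh_trajectory_0 [simp]: "hh_trajectory d 0 = d"
  by (simp add: hh_trajectory_def)

lemma hh_trajectory_Suc [simp]: "hh_trajectory d (Suc j) = hh_step (hh_trajectory d j)"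
  by (simp add: hh_trajectory_def)

text \<open>Every step shortens a nonempty list by one, so the trajectory reaches the empty list and
  the \<open>LEAST\<close> in \<open>hh_stop\<close> is attained.\<close>

lemma hh_stop_zero: "\<forall>x\<in>set (hh_trajectory d (hh_stop d)). x = 0"
proof -
  have "length (hh_step e) = length e - 1" for e by (cases e) auto
  then have "length (hh_trajectory d j) = length d - j" for j by (induction j) auto
  from this[of "length d"] show ?thesis
    unfolding hh_stop_def
    by (intro LeastI[where P = "\<lambda>j. \<forall>x\<in>set (hh_trajectory d j). x = 0" and k = "length d"]) simp
qed

lemma hh_residue_eq_recip_sum: "real (hh_residue d) = recip_sum (hh_trajectory d (hh_stop d))"
proof -
  have "real (count_list e 0) = recip_sum e" if "\<forall>x\<in>set e. x = 0" for e
    using that by (induction e) (auto simp: recip_sum_def)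
  then show ?thesis using hh_stop_zero by (simp add: hh_residue_def)
qed

context
  fixes d :: "nat list"
  assumes d: "graphic_desc d"
begin

lemma graphic_desc_trajectory: "graphic_desc (hh_trajectory d j)"
proof (induction j)
  case (Suc j)
  then show ?case by (cases "hh_trajectory d j") (auto simp: graphic_desc_Cons(4) simp del: hh_step.simps(2))
qed (simp add: d)

text \<open>Minimality of the stopping index gives a nonzero entry, hence a positive pivot. The
  pivot is at most the number of remaining entries, so the next list is nonempty too.\<close>

lemma trajectory_before_stop:
  assumes "j < hh_stop d"
  obtains D ds D' es where "hh_trajectory d j = D # ds" "graphic_desc (D # ds)" "0 < D"
    "hh_trajectory d (Suc j) = D' # es" "hh_step (D # ds) = D' # es"
proof -
  from assms obtain x where x: "x \<in> set (hh_trajectory d j)" "x \<noteq> 0"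
    unfolding hh_stop_def using not_less_Least by blast
  then obtain D ds where D: "hh_trajectory d j = D # ds" by (cases "hh_trajectory d j") auto
  with graphic_desc_trajectory[of j] have g: "graphic_desc (D # ds)" by simp
  then have "0 < D" using x D graphic_desc_Cons(3)[OF g] by fastforce
  moreover have "length (hh_step (D # ds)) \<noteq> 0" using graphic_desc_Cons(1)[OF g] \<open>0 < D\<close> by auto
  ultimately show ?thesis using that D g by (metis hh_trajectory_Suc list.exhaust list.size(3))
qed

lemma recip_sum_trajectory:
  "j \<le> hh_stop d \<Longrightarrow> recip_sum (hh_trajectory d j) = recip_sum d + (\<Sum>i<j. step_delta (hh_trajectory d i))"
proof (induction j)
  case (Suc j)
  obtain D ds where "hh_trajectory d j = D # ds" "graphic_desc (D # ds)"
    using Suc.prems trajectory_before_stop[of j] by (metis Suc_le_lessD)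
  then show ?case using Suc recip_sum_hh_step[of D ds] by (simp del: hh_step.simps(2))
qed simp

lemma residue_eq: "real (hh_residue d) = recip_sum d + (\<Sum>i<hh_stop d. step_delta (hh_trajectory d i))"
  by (simp add: hh_residue_eq_recip_sum recip_sum_trajectory)

lemma residue_ge: "recip_sum d \<le> real (hh_residue d)"
proof -
  have "0 \<le> step_delta (hh_trajectory d i)" if "i < hh_stop d" for i
    using trajectory_before_stop[OF that] step_delta_nonneg by metis
  then have "0 \<le> (\<Sum>i<hh_stop d. step_delta (hh_trajectory d i))" by (intro sum_nonneg) auto
  then show ?thesis by (simp add: residue_eq)
qed

text \<open>Telescopes \<open>step_delta_unit_band\<close>. The induction carries the unit-band
  property along because each step needs it.\<close>

lemma unit_band_tail:
  assumes "unit_band (hh_trajectory d t)" "t \<le> j" "j \<le> hh_stop d"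
  shows "unit_band (hh_trajectory d j) \<and>
    (\<Sum>i=t..<j. step_delta (hh_trajectory d i)) + band_bound (hd (hh_trajectory d j)) \<le>
      band_bound (hd (hh_trajectory d t))"
  using assms(2,3)
proof (induction rule: dec_induct)
  case base
  then show ?case using assms(1) by simp
next
  case (step j)
  obtain D ds D' es where t: "hh_trajectory d j = D # ds" "graphic_desc (D # ds)" "0 < D"
    "hh_trajectory d (Suc j) = D' # es" "hh_step (D # ds) = D' # es"
    using step.prems trajectory_before_stop[of j] by (metis Suc_le_lessD)
  have IH: "unit_band (hh_trajectory d j)"
    "(\<Sum>i=t..<j. step_delta (hh_trajectory d i)) + band_bound D \<le> band_bound (hd (hh_trajectory d t))"
    using step t(1) by auto
  have "unit_band (D' # es)" "step_delta (D # ds) + band_bound D' \<le> band_bound D"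
    using unit_band_hh_step(1)[OF t(2,3) _ t(5)] step_delta_unit_band[OF t(2,3) _ t(5)] IH(1) t(1) by auto
  then show ?case using IH(2) t step.hyps(1)
    by (simp del: hh_step.simps(2) hh_trajectory_Suc)
qed

text \<open>The contributions are split at the first unit-band step: \<open>delta_sum\<close>
  collects those before it, and the potential bounds the rest below \<open>3 / 2\<close>.\<close>

lemma residue_less: "real (hh_residue d) < recip_sum d + delta_sum d + 3 / 2"
proof (cases "\<exists>j<hh_stop d. unit_band (hh_trajectory d j)")
  case False
  then have "first_unit_band d = hh_stop d" by (metis first_unit_band_def)
  then show ?thesis by (simp add: residue_eq delta_sum_def)
next
  case True
  define t where "t = (LEAST j. unit_band (hh_trajectory d j))"
  from True obtain j where j: "j < hh_stop d" "unit_band (hh_trajectory d j)" by blast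
  \<comment> \<open>The \<open>LEAST\<close> in \<open>first_unit_band\<close> carries no bound; the
    witness \<open>j\<close> keeps it below the stopping index.\<close>
  then have t: "unit_band (hh_trajectory d t)" "t < hh_stop d"
    unfolding t_def using LeastI[of "\<lambda>j. unit_band (hh_trajectory d j)" j]
      Least_le[of "\<lambda>j. unit_band (hh_trajectory d j)" j] by auto
  have "{..<hh_stop d} = {..<t} \<union> {t..<hh_stop d}" using t(2) by auto
  then have "(\<Sum>i<hh_stop d. step_delta (hh_trajectory d i)) =
      delta_sum d + (\<Sum>i=t..<hh_stop d. step_delta (hh_trajectory d i))"
    using True by (simp add: delta_sum_def first_unit_band_def t_def[symmetric] sum.union_disjoint ivl_disj_int)
  moreover have "(\<Sum>i=t..<hh_stop d. step_delta (hh_trajectory d i)) < 3 / 2"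
    using unit_band_tail[OF t(1), of "hh_stop d"] t(2) band_bound_less[of "hd (hh_trajectory d t)"]
      band_bound_nonneg[of "hd (hh_trajectory d (hh_stop d))"] by force
  ultimately show ?thesis by (simp add: residue_eq)
qed

end

section \<open>The graphs \<open>G\<^sub>n\<close>\<close>

lemma graphic_desc_gcd_sequence: "graphic_desc (gcd_sequence n)"
  unfolding gcd_sequence_def
  by (rule graphic_desc_degree_sequence)
    (auto simp: gcd_vertices_def gcd_adj_def symp_def irreflp_def gcd.commute)

lemma recip_sum_gcd_sequence: "recip_sum (gcd_sequence n) = CW_gcd n"
  by (simp add: gcd_sequence_def CW_gcd_def recip_sum_degree_sequence)

text \<open>Makes the residue computable: from a list that is not all zero, one step lowers the
  stopping index by one and leads to the same final list.\<close>

lemma hh_residue_rec [code]: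
  "hh_residue d = (if list_all (\<lambda>x. x = 0) d then length d else hh_residue (hh_step d))"
proof (cases "\<forall>x\<in>set d. x = 0")
  case True
  then have "hh_stop d = 0" by (simp add: hh_stop_def)
  moreover have "count_list d 0 = length d" using True by (induction d) auto
  ultimately show ?thesis using True by (auto simp: hh_residue_def list_all_iff)
next
  case False
  have shift: "hh_trajectory d (Suc j) = hh_trajectory (hh_step d) j" for j
    by (simp add: hh_trajectory_def funpow_swap1)
  have "hh_stop d = Suc (hh_stop (hh_step d))"
    unfolding hh_stop_def using Least_Suc[where P = "\<lambda>j. \<forall>x\<in>set (hh_trajectory d j). x = 0", OF hh_stop_zero] False
    by (simp add: shift del: hh_trajectory_Suc)
  then show ?thesis using False
    by (auto simp: hh_residue_def list_all_iff shift simp del: hh_trajectory_Suc)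
qed

lemma gcd_sequence_code [code]:
  "gcd_sequence n = sort_desc (map (\<lambda>v. length (filter (gcd_adj v) [2..<Suc n])) [2..<Suc n])"
proof -
  have "length (filter (gcd_adj v) [2..<Suc n]) = graph_degree {2..n} gcd_adj v" for v
  proof -
    have "length (filter (gcd_adj v) [2..<Suc n]) = card (set (filter (gcd_adj v) [2..<Suc n]))"
      by (rule distinct_card[symmetric]) simp
    also have "set (filter (gcd_adj v) [2..<Suc n]) = {w \<in> {2..n}. gcd_adj v w}" by auto
    finally show ?thesis by (simp add: graph_degree_def)
  qed
  then show ?thesis
    using degree_sequence_set[of "[2..<Suc n]" gcd_adj]
    by (simp add: gcd_sequence_def gcd_vertices_def atLeastLessThanSuc_atLeastAtMost del: upt_Suc)
qed

text \<open>
  The Caro--Wei sum is bounded below in multiples of 1/12, so that only integers occur. The test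
  is a constant of its own because \<open>code_simp\<close> would unfold \<open>hh_residue\<close> forever under a binder.
\<close>

definition small_gap :: "nat list \<Rightarrow> bool" where
  "small_gap d \<longleftrightarrow> 12 * hh_residue d < (\<Sum>x\<leftarrow>d. 12 div (x + 1)) + 36"

text \<open>Settles the cases from 2 to 14, where nothing is assumed about \<open>B_gcd\<close>. The
  36 in \<open>small_gap\<close> is the gap 3 in multiples of 1/12.\<close>

lemma small_gap_gcd_sequence: "list_all small_gap (map gcd_sequence [2..<15])"
  by code_simp

lemma sum_div_le_recip_sum: "real (\<Sum>x\<leftarrow>d. 12 div (x + 1)) \<le> 12 * recip_sum d"
proof -
  have "real (12 div (x + 1)) \<le> 12 * (1 / (real x + 1))" for x
    using of_nat_div_le_of_nat[of 12 "x + 1"] by (simp add: add.commute)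
  then show ?thesis
    by (simp add: recip_sum_def o_def sum_list_mono sum_list_const_mult[symmetric] flip: sum_list_of_nat)
qed

theorem proposition16:
  assumes "\<forall>n\<ge>15. B_gcd n \<le> 3 / 2"
  shows "\<forall>n\<ge>2. \<lceil>CW_gcd n\<rceil> \<le> int (R_gcd n) \<and> int (R_gcd n) \<le> \<lceil>CW_gcd n\<rceil> + 2"
proof (intro allI impI conjI)
  fix n :: nat assume "2 \<le> n"
  note d = graphic_desc_gcd_sequence[of n]
  show "\<lceil>CW_gcd n\<rceil> \<le> int (R_gcd n)"
    using residue_ge[OF d] by (simp add: recip_sum_gcd_sequence R_gcd_def ceiling_le_iff)
  \<comment> \<open>Strictness matters: the residue is an integer below the ceiling plus 3, hence at
    most the ceiling plus 2.\<close>
  have "real (R_gcd n) < CW_gcd n + 3"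
  proof (cases "15 \<le> n")
    case True
    with assms residue_less[OF d] show ?thesis
      by (force simp: recip_sum_gcd_sequence R_gcd_def B_gcd_def)
  next
    case False
    with \<open>2 \<le> n\<close> have "n \<in> {2..<15}" by simp
    then have "gcd_sequence n \<in> set (map gcd_sequence [2..<15])" unfolding set_map set_upt by blast
    then have "small_gap (gcd_sequence n)" using small_gap_gcd_sequence unfolding list_all_iff by blast
    then have "12 * hh_residue (gcd_sequence n) < (\<Sum>x\<leftarrow>gcd_sequence n. 12 div (x + 1)) + 36"
      by (simp add: small_gap_def)
    then have "12 * real (hh_residue (gcd_sequence n)) < real (\<Sum>x\<leftarrow>gcd_sequence n. 12 div (x + 1)) + 36"
      by linarith
    with sum_div_le_recip_sum[of "gcd_sequence n"] show ?thesis
      by (simp add: recip_sum_gcd_sequence R_gcd_def)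
  qed
  then show "int (R_gcd n) \<le> \<lceil>CW_gcd n\<rceil> + 2" by linarith
qed

end
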